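(* Let a finite linear recursive specification $$E=\{X_i = X_{l(i)}\unlhd a_i\unrhd X_{r(i)} \mid i\in[1,n]\}\cup\{X_{n+1}=\mathsf S,\ X_{n+2}=\mathsf D\}$$ be given (so $l(i),r(i)\in[1,n+2]$ and $a_i\in\mathcal A$ is a basic action, for each $i\in[1,n]$). Then there exists a closed PGA term $P$ in which jump instructions do not occur such that $$\langle X_1|E\rangle = \Bigl(\bigl(\bigl(\bigl(\ldots(|P| \,/_{\mathsf{st}:1}\, BR_{\mathsf F})\ldots /_{\mathsf{st}:n+2}\, BR_{\mathsf F}\bigr) /_{\mathsf{rt}}\, BR_{\mathsf F}\bigr) /_{\mathsf{rf}}\, BR_{\mathsf F}\bigr) /_{\mathsf{en}}\, BR_{\mathsf F}\Bigr) /_{\mathsf{sk}}\, BR_{\mathsf F}.$$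
   Context: Foci, methods, actions. Fix a set $\mathcal F$ of foci and a set $\mathcal M$ of methods, and let $\mathcal A=\{f.m\mid f\in\mathcal F,m\in\mathcal M\}$ be the set of basic actions. Among the foci are $\mathsf{st}{:}j$ ($j\ge1$), $\mathsf{rt}$, $\mathsf{rf}$, $\mathsf{en}$, $\mathsf{sk}$ (differently written foci are different), which serve as names of Boolean registers; among the methods are $\mathsf{set{:}T}$, $\mathsf{set{:}F}$, $\mathsf{get}$. Basic thread algebra (BTA). One sort of threads, with constants $\mathsf D$ (deadlock), $\mathsf S$ (termination), and for each $a\in\mathcal A$ a binary operator $x\unlhd a\unrhd y$ (perform $a$; proceed as $x$ on reply $\mathsf T$ and as $y$ on reply $\mathsf F$). The abbreviation $a\circ p$ stands for $p\unlhd a\unrhd p$. A guarded recursive specification is a set of equations $E=\{X=t_X\mid X\in V\}$, where $V$ is a set of variables and each $t_X$ is $\mathsf D$, $\mathsf S$ or of the form $t\unlhd a\unrhd t'$, with only variables from $V$. It is linear if each $t_X$ is $\mathsf D$, $\mathsf S$ or $Y\unlhd a\unrhd Z$ with $Y,Z\in V$. The constant $\langle X|E\rangle$ denotes the unique solution of $E$ for $X$. Axioms: RDP, $\langle X|E\rangle=t_X[\langle Y|E\rangle/Y]_{Y\in V}$; RSP, $E\Rightarrow X=\langle X|E\rangle$. The projection operators $\pi_n$ ($n\in\mathbb N$) satisfy $\pi_0(x)=\mathsf D$, $\pi_{n+1}(\mathsf S)=\mathsf S$, $\pi_{n+1}(\mathsf D)=\mathsf D$, $\pi_{n+1}(x\unlhd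 a\unrhd y)=\pi_n(x)\unlhd a\unrhd\pi_n(y)$, and AIP: if $\pi_n(x)=\pi_n(y)$ for all $n\ge0$ then $x=y$. Services and use operators. A service is $H=(S,\mathit{eff},\mathit{yld},s_0)$ with $\mathit{eff}:\mathcal M\times S\to S$, $\mathit{yld}:\mathcal M\times S\to\{\mathsf T,\mathsf F,\mathsf B\}$, $s_0\in S$, such that $\mathit{yld}(m,s)=\mathsf B$ implies $\mathit{yld}(m',\mathit{eff}(m,s))=\mathsf B$ for all $m'$. Put $\frac{\partial}{\partial m}H=(S,\mathit{eff},\mathit{yld},\mathit{eff}(m,s_0))$ and $H(m)=\mathit{yld}(m,s_0)$. For each $f\in\mathcal F$ the use operator $x/_fH$ (thread $x$, service $H$, result a thread) satisfies: $\mathsf S/_fH=\mathsf S$; $\mathsf D/_fH=\mathsf D$; $(x\unlhd g.m\unrhd y)/_fH=(x/_fH)\unlhd g.m\unrhd(y/_fH)$ if $f\ne g$; $(x\unlhd f.m\unrhd y)/_fH$ equals $x/_f\frac{\partial}{\partial m}H$ if $H(m)=\mathsf T$, $y/_f\frac{\partial}{\partial m}H$ if $H(m)=\mathsf F$, and $\mathsf D$ if $H(m)=\mathsf B$; and if $\pi_n(x)/_fH=\pi_n(y)/_fH$ for all $n\ge0$ then $x/_fH=y/_fH$. Boolean registers. For $s\in\{\mathsf T,\mathsf F,\mathsf B\}$, $BR_s=(\{\mathsf T,\mathsf F,\mathsf B\},\mathit{eff},\mathit{eff},s)$ (effect and yield coincide), where for $b\in\{\mathsf T,\mathsf F\}$: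 $\mathit{eff}(\mathsf{set{:}T},b)=\mathsf T$, $\mathit{eff}(\mathsf{set{:}F},b)=\mathsf F$, $\mathit{eff}(\mathsf{get},b)=b$, $\mathit{eff}(m,b)=\mathsf B$ for every other method $m$, and $\mathit{eff}(m,\mathsf B)=\mathsf B$ for all $m$. Model. Threads are the elements of a fixed but arbitrary model of BTA extended with guarded recursion and the use operators (satisfying the axioms above), in which guarded recursive specifications have unique solutions; equations between threads are understood in this model. Program algebra (PGA). The set $\mathcal A$ is also used as the set of basic instructions. Primitive instructions: $a$, $+a$, $-a$ for $a\in\mathcal A$; forward jumps $\#l$ for $l\in\mathbb N$; termination $!$. Closed PGA terms are built from primitive instructions by concatenation $X;Y$ and repetition $X^\omega$; they denote non-empty finite or eventually periodic infinite instruction sequences ($X^\omega$ is $X$ repeated forever, and $X^\omega;Y=X^\omega$), and terms denoting the same sequence are identified. Thread extraction $|\cdot|$ assigns to each closed PGA term a thread, by: $|a|=|{+a}|=|{-a}|=a\circ\mathsf D$; $|a;X|=a\circ|X|$; $|{+a};X|=|X|\unlhd a\unrhd|\#2;X|$; $|{-a};X|=|\#2;X|\unlhd a\unrhd|X|$; $|\#l|=\mathsf D$; $|\#0;X|=\mathsf D$; $|\#1;X|=|X|$; $|\#(l+2);u|=\mathsf D$; $|\#(l+2);u;X|=|\#(l+1);X|$ ($u$ a primitive instruction); $|!|=|!;X|=\mathsf S$; and $|\#l;X|=\mathsf D$ if $\#l$ begins an infinite chain of jumps. For sequences with repetition these equations yield a finite guarded recursive specification, whose solution is the extracted thread.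
   Formalization: The formal theorem additionally assumes that the foci of the basic actions a_1,…,a_n are not among st:1,…,st:n+2, rt, rf, en, sk; without this the claim fails, e.g. for n=1 and X_1 = X_2 ⊴ st:1.get ⊵ X_2. *)

theory Defs
  imports Main
begin

section \<open>Threads\<close>

text \<open>The types \<open>'f\<close> and \<open>'m\<close> are the arbitrary sets of foci and methods; the basic action
  \<open>f.m\<close> is the pair \<open>(f, m)\<close>.\<close>

type_synonym ('f, 'm) action = "'f \<times> 'm"

text \<open>The recursion variables are the natural numbers. \<open>TPC x a y\<close> stands for the postconditional
  composition of \<open>x\<close> and \<open>y\<close> over \<open>a\<close> (\<open>x\<close> on reply true).\<close>

datatype ('f, 'm) bta_term =
    TVar nat
  | TD
  | TS
  | TPC "('f, 'm) bta_term" "('f, 'm) action" "('f, 'm) bta_term"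

primrec term_vars :: "('f, 'm) bta_term \<Rightarrow> nat set" where
  "term_vars (TVar X) = {X}"
| "term_vars TD = {}"
| "term_vars TS = {}"
| "term_vars (TPC t a t') = term_vars t \<union> term_vars t'"

text \<open>A set of equations with one equation per variable in \<open>V\<close> is a partial map with domain \<open>V\<close>.\<close>

type_synonym ('f, 'm) rec_spec = "nat \<rightharpoonup> ('f, 'm) bta_term"

definition guarded_spec :: "('f, 'm) rec_spec \<Rightarrow> bool" where
  "guarded_spec E \<longleftrightarrow>
     (\<forall>t \<in> ran E. (t = TD \<or> t = TS \<or> (\<exists>u a v. t = TPC u a v)) \<and> term_vars t \<subseteq> dom E)"

definition linear_spec :: "('f, 'm) rec_spec \<Rightarrow> bool" where
  "linear_spec E \<longleftrightarrow>
     (\<forall>t \<in> ran E. (t = TD \<or> t = TS \<or> (\<exists>Y a Z. t = TPC (TVar Y) a (TVar Z)))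
        \<and> term_vars t \<subseteq> dom E)"

section \<open>Services\<close>

datatype reply = TT | FF | BB

text \<open>The type \<open>'s\<close> is a universe from which the state sets of services are taken.\<close>

record ('m, 's) service =
  states :: "'s set"
  eff :: "'m \<Rightarrow> 's \<Rightarrow> 's"
  yld :: "'m \<Rightarrow> 's \<Rightarrow> reply"
  init :: 's

definition is_service :: "('m, 's) service \<Rightarrow> bool" where
  "is_service H \<longleftrightarrow>
     init H \<in> states H \<and>
     (\<forall>m. \<forall>s \<in> states H. eff H m s \<in> states H) \<and>
     (\<forall>m. \<forall>s \<in> states H. yld H m s = BB \<longrightarrow> (\<forall>m'. yld H m' (eff H m s) = BB))"

definition derived_service :: "'m \<Rightarrow> ('m, 's) service \<Rightarrow> ('m, 's) service" where
  "derived_service m H = H\<lparr>init := eff H m (init H)\<rparr>"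

definition service_reply :: "('m, 's) service \<Rightarrow> 'm \<Rightarrow> reply" where
  "service_reply H m = yld H m (init H)"

section \<open>Models\<close>

text \<open>\<open>solution E X\<close> interprets the constant for the solution of \<open>E\<close> for \<open>X\<close>;
  \<open>use_op f x H\<close> interprets \<open>x /\<^sub>f H\<close>.\<close>

record ('f, 'm, 's, 't) thread_algebra =
  deadlock :: 't
  terminated :: 't
  postcond :: "'t \<Rightarrow> ('f, 'm) action \<Rightarrow> 't \<Rightarrow> 't"
  solution :: "('f, 'm) rec_spec \<Rightarrow> nat \<Rightarrow> 't"
  proj :: "nat \<Rightarrow> 't \<Rightarrow> 't"
  use_op :: "'f \<Rightarrow> 't \<Rightarrow> ('m, 's) service \<Rightarrow> 't"

primrec eval_term ::
    "('f, 'm, 's, 't) thread_algebra \<Rightarrow> (nat \<Rightarrow> 't) \<Rightarrow> ('f, 'm) bta_term \<Rightarrow> 't" where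
  "eval_term M \<rho> (TVar X) = \<rho> X"
| "eval_term M \<rho> TD = deadlock M"
| "eval_term M \<rho> TS = terminated M"
| "eval_term M \<rho> (TPC t a t') = postcond M (eval_term M \<rho> t) a (eval_term M \<rho> t')"

definition solves ::
    "('f, 'm, 's, 't) thread_algebra \<Rightarrow> ('f, 'm) rec_spec \<Rightarrow> (nat \<Rightarrow> 't) \<Rightarrow> bool" where
  "solves M E \<rho> \<longleftrightarrow> (\<forall>X t. E X = Some t \<longrightarrow> \<rho> X = eval_term M \<rho> t)"

locale bta_model =
  fixes M :: "('f, 'm, 's, 't) thread_algebra"
  assumes RDP: "guarded_spec E \<Longrightarrow> solves M E (solution M E)"
    and RSP: "guarded_spec E \<Longrightarrow> solves M E \<rho> \<Longrightarrow> X \<in> dom E \<Longrightarrow> \<rho> X = solution M E X"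
    and proj_0: "proj M 0 x = deadlock M"
    and proj_terminated: "proj M (Suc k) (terminated M) = terminated M"
    and proj_deadlock: "proj M (Suc k) (deadlock M) = deadlock M"
    and proj_postcond:
      "proj M (Suc k) (postcond M x a y) = postcond M (proj M k x) a (proj M k y)"
    and AIP: "(\<And>k. proj M k x = proj M k y) \<Longrightarrow> x = y"
    and use_terminated: "is_service H \<Longrightarrow> use_op M f (terminated M) H = terminated M"
    and use_deadlock: "is_service H \<Longrightarrow> use_op M f (deadlock M) H = deadlock M"
    and use_other: "is_service H \<Longrightarrow> f \<noteq> g \<Longrightarrow>
      use_op M f (postcond M x (g, m) y) H
        = postcond M (use_op M f x H) (g, m) (use_op M f y H)"
    and use_true: "is_service H \<Longrightarrow> service_reply H m = TT \<Longrightarrow>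
      use_op M f (postcond M x (f, m) y) H = use_op M f x (derived_service m H)"
    and use_false: "is_service H \<Longrightarrow> service_reply H m = FF \<Longrightarrow>
      use_op M f (postcond M x (f, m) y) H = use_op M f y (derived_service m H)"
    and use_blocked: "is_service H \<Longrightarrow> service_reply H m = BB \<Longrightarrow>
      use_op M f (postcond M x (f, m) y) H = deadlock M"
    and use_approx: "is_service H \<Longrightarrow>
      (\<And>k. use_op M f (proj M k x) H = use_op M f (proj M k y) H) \<Longrightarrow>
      use_op M f x H = use_op M f y H"

section \<open>Boolean registers\<close>

locale register_names =
  fixes st :: "nat \<Rightarrow> 'f" and rt rf en sk :: 'f
    and setT setF get :: 'm
  assumes foci_distinct: "inj_on st {1..}" "distinct [rt, rf, en, sk]"
      "st ` {1..} \<inter> {rt, rf, en, sk} = {}"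
    and methods_distinct: "distinct [setT, setF, get]"

definition br_eff :: "'m \<Rightarrow> 'm \<Rightarrow> 'm \<Rightarrow> 'm \<Rightarrow> reply \<Rightarrow> reply" where
  "br_eff setT setF get m b =
     (if b = BB then BB
      else if m = setT then TT
      else if m = setF then FF
      else if m = get then b
      else BB)"

text \<open>The injection \<open>emb\<close> places the state set \<open>{TT, FF, BB}\<close> in the universe of states.\<close>

definition BR :: "'m \<Rightarrow> 'm \<Rightarrow> 'm \<Rightarrow> (reply \<Rightarrow> 's) \<Rightarrow> reply \<Rightarrow> ('m, 's) service" where
  "BR setT setF get emb s =
     \<lparr>states = range emb,
      eff = (\<lambda>m x. emb (br_eff setT setF get m (inv emb x))),
      yld = (\<lambda>m x. br_eff setT setF get m (inv emb x)),
      init = emb s\<rparr>"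

lemma is_service_BR: "inj emb \<Longrightarrow> is_service (BR setT setF get emb s)"
  by (auto simp: is_service_def BR_def br_eff_def)

section \<open>Program algebra\<close>

datatype 'a instr =
    Basic 'a
  | PosTest 'a
  | NegTest 'a
  | Jump nat
  | Halt

datatype 'a pga =
    Prim "'a instr"
  | Concat "'a pga" "'a pga"  (infixr \<open>;;\<close> 65)
  | Repeat "'a pga"

primrec instrs :: "'a pga \<Rightarrow> 'a instr set" where
  "instrs (Prim u) = {u}"
| "instrs (X ;; Y) = instrs X \<union> instrs Y"
| "instrs (Repeat X) = instrs X"

definition jump_free :: "'a pga \<Rightarrow> bool" where
  "jump_free P \<longleftrightarrow> (\<forall>l. Jump l \<notin> instrs P)"

text \<open>An instruction sequence is given by its instruction at each position, with \<open>None\<close> beyond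
  the end of a finite sequence. The value of \<open>pga_len\<close> matters for finite terms only.\<close>

type_synonym 'a iseq = "nat \<Rightarrow> 'a instr option"

primrec pga_infinite :: "'a pga \<Rightarrow> bool" where
  "pga_infinite (Prim u) = False"
| "pga_infinite (X ;; Y) = (pga_infinite X \<or> pga_infinite Y)"
| "pga_infinite (Repeat X) = True"

primrec pga_len :: "'a pga \<Rightarrow> nat" where
  "pga_len (Prim u) = 1"
| "pga_len (X ;; Y) = pga_len X + pga_len Y"
| "pga_len (Repeat X) = 0"

primrec pga_seq :: "'a pga \<Rightarrow> 'a iseq" where
  "pga_seq (Prim u) = (\<lambda>k. if k = 0 then Some u else None)"
| "pga_seq (X ;; Y) =
     (\<lambda>k. if pga_infinite X \<or> k < pga_len X then pga_seq X k else pga_seq Y (k - pga_len X))"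
| "pga_seq (Repeat X) =
     (\<lambda>k. if pga_infinite X then pga_seq X k else pga_seq X (k mod pga_len X))"

section \<open>Thread extraction\<close>

text \<open>The specification for a sequence \<open>s\<close> has one variable for each distinct suffix of \<open>s\<close>,
  namely the least position at which this suffix starts; hence it is finite whenever \<open>s\<close> is finite
  or eventually periodic. The empty suffix gets the equation for \<open>TD\<close>, which accounts for
  \<open>|a| = |+a| = |-a| = a \<circ> D\<close> and for jumps beyond the end.\<close>

definition suffix :: "nat \<Rightarrow> 'a iseq \<Rightarrow> 'a iseq" where
  "suffix k s = (\<lambda>i. s (k + i))"

definition suffix_var :: "'a iseq \<Rightarrow> nat \<Rightarrow> nat" where
  "suffix_var s k = (LEAST j. suffix j s = suffix k s)"

text \<open>\<open>suffix_rhs s k t\<close>: after finitely many jumps from position \<open>k\<close>, an instruction is reached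
  whose extraction equation has the right-hand side \<open>t\<close>.\<close>

inductive suffix_rhs :: "('f, 'm) action iseq \<Rightarrow> nat \<Rightarrow> ('f, 'm) bta_term \<Rightarrow> bool"
  for s where
  basic: "s k = Some (Basic a) \<Longrightarrow>
    suffix_rhs s k (TPC (TVar (suffix_var s (k + 1))) a (TVar (suffix_var s (k + 1))))"
| pos: "s k = Some (PosTest a) \<Longrightarrow>
    suffix_rhs s k (TPC (TVar (suffix_var s (k + 1))) a (TVar (suffix_var s (k + 2))))"
| neg: "s k = Some (NegTest a) \<Longrightarrow>
    suffix_rhs s k (TPC (TVar (suffix_var s (k + 2))) a (TVar (suffix_var s (k + 1))))"
| stop: "s k = Some Halt \<Longrightarrow> suffix_rhs s k TS"
| jump: "s k = Some (Jump l) \<Longrightarrow> 0 < l \<Longrightarrow> suffix_rhs s (k + l) t \<Longrightarrow> suffix_rhs s k t"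

definition extraction_spec :: "('f, 'm) action iseq \<Rightarrow> ('f, 'm) rec_spec" where
  "extraction_spec s X =
     (if X \<in> range (suffix_var s)
      then Some (if \<exists>t. suffix_rhs s X t then THE t. suffix_rhs s X t else TD)
      else None)"

definition thread_of ::
    "('f, 'm, 's, 't) thread_algebra \<Rightarrow> ('f, 'm) action pga \<Rightarrow> 't" where
  "thread_of M P = solution M (extraction_spec (pga_seq P)) 0"

text \<open>The specification is guarded, it is finite for every term, and the extracted threads satisfy
  the defining equations of thread extraction.\<close>

lemma suffix_suffix: "suffix i (suffix j s) = suffix (j + i) s"
  by (simp add: suffix_def add.assoc)

lemma suffix_suffix_var: "suffix (suffix_var s k) s = suffix k s"
  unfolding suffix_var_def by (rule LeastI) simp

lemma suffix_var_eq_iff: "suffix_var s j = suffix_var s k \<longleftrightarrow> suffix j s = suffix k s"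
  by (metis suffix_suffix_var suffix_var_def)

lemma suffix_var_0 [simp]: "suffix_var s 0 = 0"
  unfolding suffix_var_def by (rule Least_equality) auto

lemma suffix_var_idem [simp]: "suffix_var s (suffix_var s k) = suffix_var s k"
  by (simp add: suffix_var_eq_iff suffix_suffix_var)

lemma suffix_nth: "suffix j s = suffix k s \<Longrightarrow> s (j + i) = s (k + i)"
  by (metis suffix_def)

lemma suffix_add_cong: "suffix j s = suffix k s \<Longrightarrow> suffix (j + i) s = suffix (k + i) s"
  by (metis suffix_suffix)

lemma suffix_rhs_unique: "suffix_rhs s k t \<Longrightarrow> suffix_rhs s k t' \<Longrightarrow> t = t'"
proof (induction arbitrary: t' rule: suffix_rhs.induct)
  case (basic k a)
  from basic(2) show ?case by cases (use basic(1) in auto)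
next
  case (pos k a)
  from pos(2) show ?case by cases (use pos(1) in auto)
next
  case (neg k a)
  from neg(2) show ?case by cases (use neg(1) in auto)
next
  case (stop k)
  from stop(2) show ?case by cases (use stop(1) in auto)
next
  case (jump k l t)
  from jump.prems show ?case by cases (use jump.hyps(1) jump.IH in auto)
qed

lemma suffix_rhs_guarded:
  "suffix_rhs s k t \<Longrightarrow>
    (t = TS \<or> (\<exists>u a v. t = TPC u a v)) \<and> term_vars t \<subseteq> range (suffix_var s)"
  by (induction rule: suffix_rhs.induct) auto

lemma suffix_rhs_cong:
  assumes "suffix_rhs s k t" "suffix j s = suffix k s"
  shows "suffix_rhs s j t"
  using assms
proof (induction arbitrary: j rule: suffix_rhs.induct)
  case (basic k a)
  have "s j = s k" "suffix_var s (j + 1) = suffix_var s (k + 1)"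
    using suffix_nth[OF basic(2), of 0] suffix_add_cong[OF basic(2), of 1]
    by (simp_all only: suffix_var_eq_iff add_0_right)
  then show ?case using suffix_rhs.basic[of s j a] basic by simp
next
  case (pos k a)
  have "s j = s k" "suffix_var s (j + 1) = suffix_var s (k + 1)"
      "suffix_var s (j + 2) = suffix_var s (k + 2)"
    using suffix_nth[OF pos(2), of 0] suffix_add_cong[OF pos(2)]
    by (simp_all only: suffix_var_eq_iff add_0_right)
  then show ?case using suffix_rhs.pos[of s j a] pos by simp
next
  case (neg k a)
  have "s j = s k" "suffix_var s (j + 1) = suffix_var s (k + 1)"
      "suffix_var s (j + 2) = suffix_var s (k + 2)"
    using suffix_nth[OF neg(2), of 0] suffix_add_cong[OF neg(2)]
    by (simp_all only: suffix_var_eq_iff add_0_right)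
  then show ?case using suffix_rhs.neg[of s j a] neg by simp
next
  case (stop k)
  then show ?case using suffix_nth[OF stop(2), of 0] by (auto intro: suffix_rhs.stop)
next
  case (jump k l t)
  then show ?case
    using suffix_nth[OF jump.prems, of 0] suffix_add_cong[OF jump.prems, of l]
    by (auto intro: suffix_rhs.jump)
qed

lemma extraction_spec_Some:
  assumes "suffix_rhs s k t"
  shows "extraction_spec s (suffix_var s k) = Some t"
proof -
  have "suffix_rhs s (suffix_var s k) t"
    using assms suffix_suffix_var by (rule suffix_rhs_cong)
  moreover from this have "(THE t. suffix_rhs s (suffix_var s k) t) = t"
    by (blast intro: the_equality suffix_rhs_unique)
  ultimately show ?thesis by (auto simp: extraction_spec_def)
qed

lemma extraction_spec_TD:
  assumes "\<nexists>t. suffix_rhs s k t"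
  shows "extraction_spec s (suffix_var s k) = Some TD"
proof -
  have "\<nexists>t. suffix_rhs s (suffix_var s k) t"
    using assms suffix_rhs_cong suffix_suffix_var by metis
  then show ?thesis by (auto simp: extraction_spec_def)
qed

lemma dom_extraction_spec: "dom (extraction_spec s) = range (suffix_var s)"
  by (auto simp: extraction_spec_def dom_def split: if_splits)

lemma guarded_extraction_spec: "guarded_spec (extraction_spec s)"
  unfolding guarded_spec_def
proof
  fix t assume "t \<in> ran (extraction_spec s)"
  then obtain X where X: "extraction_spec s X = Some t" by (auto simp: ran_def)
  then obtain k where k: "X = suffix_var s k"
    by (auto simp: extraction_spec_def split: if_splits)
  show "(t = TD \<or> t = TS \<or> (\<exists>u a v. t = TPC u a v)) \<and> term_vars t \<subseteq> dom (extraction_spec s)"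
  proof (cases "\<exists>t. suffix_rhs s k t")
    case True
    then have "suffix_rhs s k t" using X k extraction_spec_Some[of s k] by auto
    then show ?thesis using suffix_rhs_guarded[of s k t] by (auto simp: dom_extraction_spec)
  next
    case False
    then show ?thesis using X k extraction_spec_TD[of s k] by simp
  qed
qed

lemma pga_len_pos: "\<not> pga_infinite X \<Longrightarrow> 0 < pga_len X"
  by (induction X) auto

lemma pga_seq_beyond: "\<not> pga_infinite X \<Longrightarrow> pga_seq X k = None \<longleftrightarrow> pga_len X \<le> k"
  by (induction X arbitrary: k) auto

lemma pga_seq_eventually_periodic:
  "pga_infinite X \<Longrightarrow> \<exists>j p. 0 < p \<and> (\<forall>k\<ge>j. pga_seq X (k + p) = pga_seq X k)"
proof (induction X)
  case (Prim u)
  then show ?case by simp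
next
  case (Concat X Y)
  show ?case
  proof (cases "pga_infinite X")
    case True
    then show ?thesis using Concat.IH(1) by auto
  next
    case False
    then obtain j p where jp: "0 < p" "\<And>k. k \<ge> j \<Longrightarrow> pga_seq Y (k + p) = pga_seq Y k"
      using Concat by auto
    have "pga_seq (X ;; Y) (k + p) = pga_seq (X ;; Y) k" if "k \<ge> j + pga_len X" for k
      using jp(2)[of "k - pga_len X"] that False by simp
    then show ?thesis using jp(1) by blast
  qed
next
  case (Repeat X)
  show ?case
  proof (cases "pga_infinite X")
    case True
    then show ?thesis using Repeat.IH by auto
  next
    case False
    then have "\<forall>k\<ge>0. pga_seq (Repeat X) (k + pga_len X) = pga_seq (Repeat X) k" by simp
    then show ?thesis using pga_len_pos[OF False] by blast
  qed
qed

lemma finite_extraction_spec: "finite (dom (extraction_spec (pga_seq P)))"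
proof -
  let ?s = "pga_seq P"
  have "\<exists>b. \<forall>k. \<exists>i\<le>b. suffix i ?s = suffix k ?s"
  proof (cases "pga_infinite P")
    case True
    then obtain j p where p: "0 < p" and per: "\<And>k. k \<ge> j \<Longrightarrow> ?s (k + p) = ?s k"
      using pga_seq_eventually_periodic[OF True] by auto
    have step: "suffix (k + p) ?s = suffix k ?s" if "k \<ge> j" for k
    proof
      fix i show "suffix (k + p) ?s i = suffix k ?s i"
        using per[of "k + i"] that by (simp add: suffix_def ac_simps)
    qed
    have "\<exists>i\<le>j + p. suffix i ?s = suffix k ?s" for k
    proof (induction k rule: less_induct)
      case (less k)
      show ?case
      proof (cases "k \<le> j + p")
        case True then show ?thesis by blast
      next
        case False
        then show ?thesis using less[of "k - p"] step[of "k - p"] p by simp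
      qed
    qed
    then show ?thesis by blast
  next
    case False
    have "\<exists>i\<le>pga_len P. suffix i ?s = suffix k ?s" for k
    proof (cases "k \<le> pga_len P")
      case True then show ?thesis by blast
    next
      case k: False
      have "?s (pga_len P + i) = ?s (k + i)" for i
      proof -
        have "?s (pga_len P + i) = None" "?s (k + i) = None"
          using pga_seq_beyond[OF False] k by auto
        then show ?thesis by simp
      qed
      then show ?thesis by (auto simp: suffix_def)
    qed
    then show ?thesis by blast
  qed
  then obtain b where b: "\<And>k. \<exists>i\<le>b. suffix i ?s = suffix k ?s" by blast
  have "suffix_var ?s k \<le> b" for k
  proof -
    obtain i where "i \<le> b" "suffix i ?s = suffix k ?s" using b by blast
    then show ?thesis unfolding suffix_var_def by (metis (mono_tags, lifting) Least_le le_trans)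
  qed
  then show ?thesis
    unfolding dom_extraction_spec by (auto intro: finite_subset[of _ "{..b}"])
qed

definition seq_thread ::
    "('f, 'm, 's, 't) thread_algebra \<Rightarrow> ('f, 'm) action iseq \<Rightarrow> nat \<Rightarrow> 't" where
  "seq_thread M s k = solution M (extraction_spec s) (suffix_var s k)"

lemma seq_thread_cong: "suffix j s = suffix k s \<Longrightarrow> seq_thread M s j = seq_thread M s k"
  by (simp add: seq_thread_def suffix_var_eq_iff[symmetric])

lemma thread_of_seq_thread: "thread_of M P = seq_thread M (pga_seq P) 0"
  by (simp add: thread_of_def seq_thread_def)

context bta_model
begin

lemma seq_thread_eq:
  assumes "extraction_spec s (suffix_var s k) = Some t"
  shows "seq_thread M s k = eval_term M (solution M (extraction_spec s)) t"
  using RDP[OF guarded_extraction_spec, of s] assms by (simp only: solves_def seq_thread_def)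

lemma seq_thread_rhs:
  "suffix_rhs s k t \<Longrightarrow> seq_thread M s k = eval_term M (solution M (extraction_spec s)) t"
  by (rule seq_thread_eq) (rule extraction_spec_Some)

lemma seq_thread_TD: "\<nexists>t. suffix_rhs s k t \<Longrightarrow> seq_thread M s k = deadlock M"
  by (simp add: seq_thread_eq[OF extraction_spec_TD])

lemma seq_thread_basic:
  "s k = Some (Basic a) \<Longrightarrow>
    seq_thread M s k = postcond M (seq_thread M s (k + 1)) a (seq_thread M s (k + 1))"
  by (drule suffix_rhs.basic, drule seq_thread_rhs) (simp add: seq_thread_def)

lemma seq_thread_pos:
  "s k = Some (PosTest a) \<Longrightarrow>
    seq_thread M s k = postcond M (seq_thread M s (k + 1)) a (seq_thread M s (k + 2))"
  by (drule suffix_rhs.pos, drule seq_thread_rhs) (simp add: seq_thread_def)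

lemma seq_thread_neg:
  "s k = Some (NegTest a) \<Longrightarrow>
    seq_thread M s k = postcond M (seq_thread M s (k + 2)) a (seq_thread M s (k + 1))"
  by (drule suffix_rhs.neg, drule seq_thread_rhs) (simp add: seq_thread_def)

lemma seq_thread_halt: "s k = Some Halt \<Longrightarrow> seq_thread M s k = terminated M"
  by (drule suffix_rhs.stop, drule seq_thread_rhs) simp

lemma seq_thread_end:
  assumes "s k = None"
  shows "seq_thread M s k = deadlock M"
proof -
  have False if "suffix_rhs s k t" for t
    using that by cases (use assms in auto)
  then show ?thesis by (blast intro: seq_thread_TD)
qed

lemma seq_thread_jump_0:
  assumes "s k = Some (Jump 0)"
  shows "seq_thread M s k = deadlock M"
proof -
  have False if "suffix_rhs s k t" for t
    using that by cases (use assms in auto)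
  then show ?thesis by (blast intro: seq_thread_TD)
qed

lemma seq_thread_jump:
  assumes "s k = Some (Jump l)" "0 < l"
  shows "seq_thread M s k = seq_thread M s (k + l)"
proof (cases "\<exists>t. suffix_rhs s (k + l) t")
  case True
  then obtain t where "suffix_rhs s (k + l) t" by blast
  then show ?thesis using assms by (metis seq_thread_rhs suffix_rhs.jump)
next
  case False
  have "suffix_rhs s (k + l) t" if "suffix_rhs s k t" for t
    using that by cases (use assms in auto)
  then show ?thesis using False by (metis seq_thread_TD)
qed

lemma seq_thread_jump_chain:
  assumes "\<And>i. \<exists>l>0. s (p i) = Some (Jump l) \<and> p (Suc i) = p i + l"
  shows "seq_thread M s (p 0) = deadlock M"
proof (rule seq_thread_TD)
  have "k \<noteq> p i" if "suffix_rhs s k t" for k t i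
    using that
  proof (induction arbitrary: i rule: suffix_rhs.induct)
    case (jump k l t)
    show ?case
    proof
      assume "k = p i"
      then have "p (Suc i) = k + l" using assms[of i] jump.hyps(1) by auto
      then show False using jump.IH[of "Suc i"] by simp
    qed
  next
    case (basic k a)
    then show ?case using assms[of i] by auto
  next
    case (pos k a)
    then show ?case using assms[of i] by auto
  next
    case (neg k a)
    then show ?case using assms[of i] by auto
  next
    case (stop k)
    then show ?case using assms[of i] by auto
  qed
  then show "\<nexists>t. suffix_rhs s (p 0) t" by blast
qed

lemma seq_thread_suffix: "seq_thread M (suffix j s) k = seq_thread M s (j + k)"
proof -
  let ?s = "suffix j s" and ?\<rho> = "\<lambda>X. seq_thread M s (j + X)"
  have var: "?\<rho> (suffix_var ?s i) = ?\<rho> i" for i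
    by (rule seq_thread_cong) (metis suffix_suffix suffix_suffix_var)
  have val: "?\<rho> i = eval_term M ?\<rho> t" if "suffix_rhs ?s i t" for i t
    using that
  proof (induction rule: suffix_rhs.induct)
    case (basic i a)
    then show ?case using seq_thread_basic[of s "j + i" a] var[of "i + 1"]
      by (simp add: suffix_def[of j s])
  next
    case (pos i a)
    then show ?case using seq_thread_pos[of s "j + i" a] var[of "i + 1"] var[of "i + 2"]
      by (simp add: suffix_def[of j s])
  next
    case (neg i a)
    then show ?case using seq_thread_neg[of s "j + i" a] var[of "i + 1"] var[of "i + 2"]
      by (simp add: suffix_def[of j s])
  next
    case (stop i)
    then show ?case by (simp add: suffix_def[of j s] seq_thread_halt)
  next
    case (jump i l t)
    then show ?case using seq_thread_jump[of s "j + i" l]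
      by (simp add: suffix_def[of j s] add.assoc)
  qed
  have ex: "\<exists>t'. suffix_rhs ?s i t'" if "suffix_rhs s k' t" "k' = j + i" for k' i t
    using that
  proof (induction arbitrary: i rule: suffix_rhs.induct)
    case (jump k' l t)
    then obtain t' where "suffix_rhs ?s (i + l) t'" using add.assoc by blast
    then show ?case using jump suffix_rhs.jump[of ?s i l t'] by (auto simp: suffix_def[of j s])
  qed (metis suffix_def suffix_rhs.basic suffix_rhs.pos suffix_rhs.neg suffix_rhs.stop)+
  have "solves M (extraction_spec ?s) ?\<rho>"
    unfolding solves_def
  proof (intro allI impI)
    fix X t assume X: "extraction_spec ?s X = Some t"
    then obtain i where i: "X = suffix_var ?s i"
      by (auto simp: extraction_spec_def split: if_splits)
    show "?\<rho> X = eval_term M ?\<rho> t"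
    proof (cases "\<exists>t. suffix_rhs ?s i t")
      case True
      then have "suffix_rhs ?s i t" using X i extraction_spec_Some[of ?s i] by auto
      then show ?thesis using val var i by simp
    next
      case False
      then have "t = TD" using X i extraction_spec_TD[of ?s i] by simp
      moreover have "?\<rho> i = deadlock M"
        using False ex by (intro seq_thread_TD) blast
      ultimately show ?thesis using var i by simp
    qed
  qed
  from RSP[OF guarded_extraction_spec this, of "suffix_var ?s k"]
  have "?\<rho> (suffix_var ?s k) = seq_thread M ?s k"
    by (simp add: dom_extraction_spec seq_thread_def)
  then show ?thesis using var by simp
qed

lemma suffix_1_Prim: "suffix (Suc 0) (pga_seq (Prim u ;; X)) = pga_seq X"
  by (simp add: suffix_def)

lemma seq_thread_Suc: "seq_thread M (pga_seq (Prim u ;; X)) (Suc k) = seq_thread M (pga_seq X) k"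
  using seq_thread_suffix[of "Suc 0" "pga_seq (Prim u ;; X)" k] unfolding suffix_1_Prim by simp

lemma thread_of_Prim:
  "thread_of M (Prim (Basic a)) = postcond M (deadlock M) a (deadlock M)"
  "thread_of M (Prim (PosTest a)) = postcond M (deadlock M) a (deadlock M)"
  "thread_of M (Prim (NegTest a)) = postcond M (deadlock M) a (deadlock M)"
  "thread_of M (Prim (Jump l)) = deadlock M"
  "thread_of M (Prim Halt) = terminated M"
  by (cases "l = 0"; simp add: thread_of_seq_thread seq_thread_basic seq_thread_pos seq_thread_neg
      seq_thread_halt seq_thread_jump seq_thread_jump_0 seq_thread_end)+

lemma thread_of_Concat:
  "thread_of M (Prim (Basic a) ;; X) = postcond M (thread_of M X) a (thread_of M X)"
  "thread_of M (Prim (PosTest a) ;; X)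
    = postcond M (thread_of M X) a (thread_of M (Prim (Jump 2) ;; X))"
  "thread_of M (Prim (NegTest a) ;; X)
    = postcond M (thread_of M (Prim (Jump 2) ;; X)) a (thread_of M X)"
  "thread_of M (Prim (Jump 0) ;; X) = deadlock M"
  "thread_of M (Prim (Jump 1) ;; X) = thread_of M X"
  "thread_of M (Prim (Jump (l + 2)) ;; Prim u) = deadlock M"
  "thread_of M (Prim (Jump (l + 2)) ;; Prim u ;; X) = thread_of M (Prim (Jump (l + 1)) ;; X)"
  "thread_of M (Prim Halt ;; X) = terminated M"
proof -
  have head: "pga_seq (Prim u ;; X) 0 = Some u" for u X by simp
  have J: "thread_of M (Prim (Jump (Suc l)) ;; X) = seq_thread M (pga_seq X) l" for l X
    using seq_thread_jump[of "pga_seq (Prim (Jump (Suc l)) ;; X)" 0 "Suc l"]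
      head[of "Jump (Suc l)" X] seq_thread_Suc[of "Jump (Suc l)" X l]
    by (simp add: thread_of_seq_thread del: pga_seq.simps)
  show "thread_of M (Prim (Basic a) ;; X) = postcond M (thread_of M X) a (thread_of M X)"
    using seq_thread_basic[of "pga_seq (Prim (Basic a) ;; X)" 0 a]
      seq_thread_Suc[of "Basic a" X 0] head[of "Basic a" X]
    by (simp add: thread_of_seq_thread del: pga_seq.simps)
  show "thread_of M (Prim (PosTest a) ;; X)
      = postcond M (thread_of M X) a (thread_of M (Prim (Jump 2) ;; X))"
    using seq_thread_pos[of "pga_seq (Prim (PosTest a) ;; X)" 0 a]
      seq_thread_Suc[of "PosTest a" X 0] seq_thread_Suc[of "PosTest a" X 1] J[of 1]
      head[of "PosTest a" X]
    by (simp add: thread_of_seq_thread numeral_2_eq_2 del: pga_seq.simps)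
  show "thread_of M (Prim (NegTest a) ;; X)
      = postcond M (thread_of M (Prim (Jump 2) ;; X)) a (thread_of M X)"
    using seq_thread_neg[of "pga_seq (Prim (NegTest a) ;; X)" 0 a]
      seq_thread_Suc[of "NegTest a" X 0] seq_thread_Suc[of "NegTest a" X 1] J[of 1]
      head[of "NegTest a" X]
    by (simp add: thread_of_seq_thread numeral_2_eq_2 del: pga_seq.simps)
  show "thread_of M (Prim (Jump 0) ;; X) = deadlock M"
    unfolding thread_of_seq_thread by (rule seq_thread_jump_0) (rule head)
  show "thread_of M (Prim (Jump 1) ;; X) = thread_of M X"
    using J[of 0 X] by (simp add: thread_of_seq_thread del: pga_seq.simps)
  show "thread_of M (Prim (Jump (l + 2)) ;; Prim u) = deadlock M"
    using J[of "Suc l"] by (simp add: seq_thread_end)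
  show "thread_of M (Prim (Jump (l + 2)) ;; Prim u ;; X) = thread_of M (Prim (Jump (l + 1)) ;; X)"
    using J[of "Suc l"] J[of l] seq_thread_Suc[of u X l] by (simp del: pga_seq.simps)
  show "thread_of M (Prim Halt ;; X) = terminated M"
    unfolding thread_of_seq_thread by (rule seq_thread_halt) (rule head)
qed

end

section \<open>Linear specifications and repeated use\<close>

definition fin_lin_spec ::
    "nat \<Rightarrow> (nat \<Rightarrow> nat) \<Rightarrow> (nat \<Rightarrow> ('f, 'm) action) \<Rightarrow> (nat \<Rightarrow> nat) \<Rightarrow> ('f, 'm) rec_spec" where
  "fin_lin_spec n l a r i =
     (if i \<in> {1..n} then Some (TPC (TVar (l i)) (a i) (TVar (r i)))
      else if i = n + 1 then Some TS
      else if i = n + 2 then Some TD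
      else None)"

lemma linear_fin_lin_spec:
  assumes "\<And>i. i \<in> {1..n} \<Longrightarrow> l i \<in> {1..n + 2} \<and> r i \<in> {1..n + 2}"
  shows "dom (fin_lin_spec n l a r) = {1..n + 2}" "linear_spec (fin_lin_spec n l a r)"
proof -
  show dom: "dom (fin_lin_spec n l a r) = {1..n + 2}"
    by (auto simp: fin_lin_spec_def dom_def)
  show "linear_spec (fin_lin_spec n l a r)"
    unfolding linear_spec_def dom
  proof
    fix t assume "t \<in> ran (fin_lin_spec n l a r)"
    then obtain i where "fin_lin_spec n l a r i = Some t" by (auto simp: ran_def)
    then consider "i \<in> {1..n}" "t = TPC (TVar (l i)) (a i) (TVar (r i))" | "t = TS" | "t = TD"
      unfolding fin_lin_spec_def by (metis option.distinct(1) option.inject)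
    then show "(t = TD \<or> t = TS \<or> (\<exists>Y b Z. t = TPC (TVar Y) b (TVar Z)))
        \<and> term_vars t \<subseteq> {1..n + 2}"
      by cases (use assms in simp_all)
  qed
qed

text \<open>\<open>use_all M fs x H\<close> applies the use operators for the foci in \<open>fs\<close>, the first one innermost.\<close>

definition use_all ::
    "('f, 'm, 's, 't) thread_algebra \<Rightarrow> 'f list \<Rightarrow> 't \<Rightarrow> ('m, 's) service \<Rightarrow> 't" where
  "use_all M fs x H = foldl (\<lambda>y f. use_op M f y H) x fs"

end

theory Submission
  imports Defs
begin

text \<open>The state of the simulated specification is kept one-hot in the registers \<open>st:i\<close>: being at
  \<open>X\<^sub>i\<close> means that \<open>st:i\<close> holds true. The program first sets \<open>st:1\<close> and then repeats a body that
  consists of one block per \<open>i \<in> [1,n]\<close>, the test for \<open>X\<^bsub>n+1\<^esub>\<close> and one action on \<open>sk\<close>. A block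
  whose \<open>i\<close> is not current leaves all registers unchanged; the current one performs \<open>a\<^sub>i\<close> and moves
  the mark to \<open>l(i)\<close> or \<open>r(i)\<close>, so the marked threads satisfy the given equations and RSP applies.
  At \<open>X\<^bsub>n+2\<^esub>\<close> every pass is internal. Once the other registers are used up, what remains there
  is a thread \<open>y\<close> with \<open>y = sk.set:F \<circ> y\<close>, and using \<open>sk\<close> turns \<open>y\<close> into deadlock.\<close>

section \<open>Instruction lists\<close>

text \<open>Closed PGA terms denote non-empty sequences, hence the separate first
  instruction.\<close>

primrec pga_of_list :: "'a instr \<Rightarrow> 'a instr list \<Rightarrow> 'a pga" where
  "pga_of_list u [] = Prim u"
| "pga_of_list u (v # us) = Prim u ;; pga_of_list v us"

lemma pga_of_list_simps [simp]:
  "instrs (pga_of_list u us) = set (u # us)"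
  "\<not> pga_infinite (pga_of_list u us)"
  "pga_len (pga_of_list u us) = Suc (length us)"
  by (induction us arbitrary: u) auto

lemma pga_seq_pga_of_list:
  "k < Suc (length us) \<Longrightarrow> pga_seq (pga_of_list u us) k = Some ((u # us) ! k)"
  by (induction us arbitrary: u k) (auto simp: nth_Cons')

definition occurs_at :: "'a iseq \<Rightarrow> nat \<Rightarrow> 'a instr list \<Rightarrow> bool" where
  "occurs_at s k us \<longleftrightarrow> (\<forall>i < length us. s (k + i) = Some (us ! i))"

lemma occurs_at_Nil [simp]: "occurs_at s k []"
  by (simp add: occurs_at_def)

lemma occurs_at_Cons [simp]:
  "occurs_at s k (u # us) \<longleftrightarrow> s k = Some u \<and> occurs_at s (Suc k) us"
  by (auto simp: occurs_at_def less_Suc_eq_0_disj)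

lemma occurs_at_append [simp]:
  "occurs_at s k (us @ vs) \<longleftrightarrow> occurs_at s k us \<and> occurs_at s (k + length us) vs"
  by (induction us arbitrary: k) auto

lemma occurs_at_concat:
  assumes "occurs_at s k (concat (map f xs))" "\<And>x. x \<in> set xs \<Longrightarrow> length (f x) = d" "i < length xs"
  shows "occurs_at s (k + d * i) (f (xs ! i))"
  using assms
proof (induction xs arbitrary: k i)
  case (Cons x xs)
  show ?case
  proof (cases i)
    case 0
    then show ?thesis using Cons.prems by simp
  next
    case (Suc j)
    then have "occurs_at s (k + d + d * j) (f (xs ! j))"
      using Cons.prems by (intro Cons.IH) auto
    then show ?thesis using Suc by (simp add: ac_simps)
  qed
qed simp

section \<open>Using several registers\<close>

context bta_model
begin

text \<open>Each projection of \<open>y\<close> is a finite stack of actions \<open>f.m\<close> over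
  deadlock. Using \<open>f\<close> consumes the whole stack, so \<open>y\<close> and deadlock agree
  on all approximations.\<close>

lemma use_loop_deadlock:
  assumes H: "is_service H" and y: "y = postcond M y (f, m) y"
    and "derived_service m H = H" "service_reply H m \<noteq> BB"
  shows "use_op M f y H = deadlock M"
proof -
  have "use_op M f (proj M k y) H = deadlock M" for k
  proof (induction k)
    case 0
    then show ?case using H by (simp add: proj_0 use_deadlock)
  next
    case (Suc k)
    have "proj M (Suc k) y = postcond M (proj M k y) (f, m) (proj M k y)"
      by (subst y) (rule proj_postcond)
    then show ?case using Suc assms use_true[of H m f] use_false[of H m f]
      by (cases "service_reply H m") auto
  qed
  moreover have "use_op M f (proj M k (deadlock M)) H = deadlock M" for k
    using H by (cases k) (simp_all add: proj_0 proj_deadlock use_deadlock)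
  ultimately show ?thesis using use_approx[of H f y "deadlock M"] H by (simp add: use_deadlock)
qed

end

locale bta_registers = bta_model M + register_names st rt rf en sk setT setF get
  for M :: "('f, 'm, 's, 't) thread_algebra"
    and st :: "nat \<Rightarrow> 'f" and rt rf en sk :: 'f and setT setF get :: 'm +
  fixes emb :: "reply \<Rightarrow> 's"
  assumes inj_emb: "inj emb"
begin

abbreviation "reg \<equiv> BR setT setF get emb"
abbreviation "reg_eff \<equiv> br_eff setT setF get"

lemma reg_service [simp]: "is_service (reg b)"
  by (rule is_service_BR) (rule inj_emb)

lemma service_reply_reg [simp]: "service_reply (reg b) m = reg_eff m b"
  by (simp add: service_reply_def BR_def inj_emb)

lemma derived_service_reg [simp]: "derived_service m (reg b) = reg (reg_eff m b)"
  by (simp add: derived_service_def BR_def inj_emb)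

lemma reg_eff_simps [simp]:
  "b \<noteq> BB \<Longrightarrow> reg_eff setT b = TT"
  "b \<noteq> BB \<Longrightarrow> reg_eff setF b = FF"
  "reg_eff get b = b"
  using methods_distinct by (auto simp: br_eff_def)

text \<open>Register contents diverge during execution, so \<open>\<sigma>\<close> assigns one to
  each focus; \<open>use_all\<close> with a register is the case of constant
  \<open>\<sigma>\<close>.\<close>

definition use_regs :: "'f list \<Rightarrow> ('f \<Rightarrow> reply) \<Rightarrow> 't \<Rightarrow> 't" where
  "use_regs fs \<sigma> x = foldl (\<lambda>y f. use_op M f y (reg (\<sigma> f))) x fs"

lemma use_regs_simps [simp]:
  "use_regs [] \<sigma> x = x"
  "use_regs (f # fs) \<sigma> x = use_regs fs \<sigma> (use_op M f x (reg (\<sigma> f)))"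
  by (simp_all add: use_regs_def)

lemma use_regs_terminated: "use_regs fs \<sigma> (terminated M) = terminated M"
  by (induction fs) (simp_all add: use_terminated)

lemma use_regs_upd: "f \<notin> set fs \<Longrightarrow> use_regs fs (\<sigma>(f := b)) x = use_regs fs \<sigma> x"
  by (induction fs arbitrary: x) auto

lemma use_regs_other:
  "fst c \<notin> set fs \<Longrightarrow>
    use_regs fs \<sigma> (postcond M x c y) = postcond M (use_regs fs \<sigma> x) c (use_regs fs \<sigma> y)"
  by (cases c, induction fs arbitrary: x y) (auto simp: use_other)

text \<open>The operators inside the one for \<open>f\<close> let the action pass and that one
  consumes it. As \<open>fs\<close> is distinct, no other operator reads \<open>\<sigma>\<close> at
  \<open>f\<close>.\<close>

lemma use_regs_step:
  assumes "f \<in> set fs" "distinct fs" "reg_eff m (\<sigma> f) \<noteq> BB"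
  shows "use_regs fs \<sigma> (postcond M x (f, m) y) =
    use_regs fs (\<sigma>(f := reg_eff m (\<sigma> f))) (if reg_eff m (\<sigma> f) = TT then x else y)"
  using assms
proof (induction fs arbitrary: x y)
  case (Cons g fs)
  show ?case
  proof (cases "f = g")
    case True
    have "g \<notin> set fs" using Cons.prems by simp
    then have upd: "use_regs (g # fs) (\<sigma>(g := b)) z = use_regs fs \<sigma> (use_op M g z (reg b))"
      for b z
      by (simp only: use_regs_simps use_regs_upd fun_upd_same not_False_eq_True)
    show ?thesis using Cons.prems(3) unfolding True upd
      by (cases "reg_eff m (\<sigma> g)") (simp_all add: use_true use_false)
  next
    case False
    then show ?thesis using Cons by (auto simp: use_other)
  qed
qed simp

lemma use_regs_get:
  "f \<in> set fs \<Longrightarrow> distinct fs \<Longrightarrow> \<sigma> f \<noteq> BB \<Longrightarrow>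
    use_regs fs \<sigma> (postcond M x (f, get) y) = use_regs fs \<sigma> (if \<sigma> f = TT then x else y)"
  using use_regs_step[of f fs get \<sigma> x y] by simp

section \<open>Executing instructions on registers only\<close>

abbreviation upd_reg :: "'f \<Rightarrow> 'm \<Rightarrow> ('f \<Rightarrow> reply) \<Rightarrow> 'f \<Rightarrow> reply" where
  "upd_reg f m \<sigma> \<equiv> \<sigma>(f := reg_eff m (\<sigma> f))"

text \<open>A skipped instruction is dropped by \<open>tl\<close>. Jumps and termination get dummy
  values; \<open>reg_instrs\<close> excludes them.\<close>

fun run_regs :: "('f, 'm) action instr list \<Rightarrow> ('f \<Rightarrow> reply) \<Rightarrow> 'f \<Rightarrow> reply" where
  "run_regs [] \<sigma> = \<sigma>"
| "run_regs (Basic (f, m) # us) \<sigma> = run_regs us (upd_reg f m \<sigma>)"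
| "run_regs (PosTest (f, m) # us) \<sigma> =
     run_regs (if reg_eff m (\<sigma> f) = TT then us else tl us) (upd_reg f m \<sigma>)"
| "run_regs (NegTest (f, m) # us) \<sigma> =
     run_regs (if reg_eff m (\<sigma> f) = TT then tl us else us) (upd_reg f m \<sigma>)"
| "run_regs (Jump l # us) \<sigma> = \<sigma>"
| "run_regs (Halt # us) \<sigma> = \<sigma>"

text \<open>The last instruction must not be a test, lest execution skip past the end of the list.\<close>

fun reg_instrs :: "'f set \<Rightarrow> ('f, 'm) action instr list \<Rightarrow> bool" where
  "reg_instrs F [] = True"
| "reg_instrs F (Basic (f, m) # us) = (f \<in> F \<and> m \<in> {setT, setF, get} \<and> reg_instrs F us)"
| "reg_instrs F (PosTest (f, m) # us) =
     (f \<in> F \<and> m \<in> {setT, setF, get} \<and> us \<noteq> [] \<and> reg_instrs F us)"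
| "reg_instrs F (NegTest (f, m) # us) =
     (f \<in> F \<and> m \<in> {setT, setF, get} \<and> us \<noteq> [] \<and> reg_instrs F us)"
| "reg_instrs F (Jump l # us) = False"
| "reg_instrs F (Halt # us) = False"

lemma reg_instrs_tl: "reg_instrs F us \<Longrightarrow> reg_instrs F (tl us)"
  by (cases "(F, us)" rule: reg_instrs.cases) auto

lemma reg_eff_not_BB: "m \<in> {setT, setF, get} \<Longrightarrow> b \<noteq> BB \<Longrightarrow> reg_eff m b \<noteq> BB"
  by auto

definition use_seq :: "'f list \<Rightarrow> ('f, 'm) action iseq \<Rightarrow> nat \<Rightarrow> ('f \<Rightarrow> reply) \<Rightarrow> 't" where
  "use_seq fs s k \<sigma> = use_regs fs \<sigma> (seq_thread M s k)"

lemma upd_reg_not_BB: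
  "m \<in> {setT, setF, get} \<Longrightarrow> f \<in> F \<Longrightarrow> BB \<notin> \<sigma> ` F \<Longrightarrow> BB \<notin> upd_reg f m \<sigma> ` F"
  using reg_eff_not_BB[of m "\<sigma> f"] by (auto simp: image_iff simp del: reg_eff_simps)

text \<open>Every action addresses a used register and none is blocked, so all are consumed and only
  the change of register contents remains.\<close>

lemma use_seq_run_regs:
  assumes "distinct fs" "reg_instrs (set fs) us" "occurs_at s k us" "BB \<notin> \<sigma> ` set fs"
  shows "use_seq fs s k \<sigma> = use_seq fs s (k + length us) (run_regs us \<sigma>)"
  using assms
proof (induction us \<sigma> arbitrary: k rule: run_regs.induct)
  case (2 f m us \<sigma>)
  let ?\<sigma> = "upd_reg f m \<sigma>"
  have nb: "BB \<notin> ?\<sigma> ` set fs" using 2 by (intro upd_reg_not_BB) auto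
  have "use_seq fs s k \<sigma> = use_seq fs s (Suc k) ?\<sigma>"
    using 2 nb by (simp add: use_seq_def seq_thread_basic use_regs_step image_iff)
  also have "\<dots> = use_seq fs s (Suc k + length us) (run_regs us ?\<sigma>)"
    using 2 nb by (intro "2.IH") auto
  finally show ?case by simp
next
  case (3 f m us \<sigma>)
  let ?\<sigma> = "upd_reg f m \<sigma>" and ?T = "reg_eff m (\<sigma> f) = TT"
  let ?us = "if ?T then us else tl us" and ?k = "if ?T then Suc k else Suc (Suc k)"
  have nb: "BB \<notin> ?\<sigma> ` set fs" using 3 by (intro upd_reg_not_BB) auto
  obtain v vs where us: "us = v # vs" using 3 by (cases us) auto
  have "use_seq fs s k \<sigma> = use_seq fs s ?k ?\<sigma>"
    using 3 nb by (simp add: use_seq_def seq_thread_pos use_regs_step image_iff)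
  also have "\<dots> = use_seq fs s (?k + length ?us) (run_regs ?us ?\<sigma>)"
    using 3 nb us reg_instrs_tl[of "set fs" us] by (intro "3.IH") auto
  \<comment> \<open>A skip advances the position by one more and shortens the rest by one; this
    needs \<open>us\<close> to be non-empty.\<close>
  also have "?k + length ?us = k + length (PosTest (f, m) # us)"
    using us by simp
  finally show ?case by (simp only: run_regs.simps)
next
  case (4 f m us \<sigma>)
  let ?\<sigma> = "upd_reg f m \<sigma>" and ?T = "reg_eff m (\<sigma> f) = TT"
  let ?us = "if ?T then tl us else us" and ?k = "if ?T then Suc (Suc k) else Suc k"
  have nb: "BB \<notin> ?\<sigma> ` set fs" using 4 by (intro upd_reg_not_BB) auto
  obtain v vs where us: "us = v # vs" using 4 by (cases us) auto
  have "use_seq fs s k \<sigma> = use_seq fs s ?k ?\<sigma>"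
    using 4 nb by (simp add: use_seq_def seq_thread_neg use_regs_step image_iff)
  also have "\<dots> = use_seq fs s (?k + length ?us) (run_regs ?us ?\<sigma>)"
    using 4 nb us reg_instrs_tl[of "set fs" us] by (intro "4.IH") auto
  also have "?k + length ?us = k + length (NegTest (f, m) # us)"
    using us by simp
  finally show ?case by (simp only: run_regs.simps)
qed simp_all

section \<open>The program\<close>

text \<open>\<open>rt\<close> stays false exactly if \<open>X\<^sub>i\<close> is current and the reply is negative: a test skips only
  one instruction, so if \<open>X\<^sub>i\<close> is not current, \<open>a\<^sub>i\<close> is skipped but \<open>rt.set:T\<close> is performed. Hence
  \<open>rf\<close> is needed to recognize a positive reply.\<close>

definition update_block :: "nat \<Rightarrow> nat \<Rightarrow> nat \<Rightarrow> ('f, 'm) action instr list" where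
  "update_block i p q =
     [Basic (rt, setT), PosTest (st i, get), Basic (rf, setT), NegTest (rt, get), Basic (rf, setF),
      Basic (st i, setF), PosTest (rf, get), Basic (st p, setT), NegTest (rt, get),
      Basic (st q, setT), Basic (rt, setF), Basic (rf, setF)]"

text \<open>If \<open>st i\<close> is false, the first test skips \<open>c\<close> and the update
  runs from its start. Otherwise \<open>c\<close> is performed: a positive reply enters the update
  at its start, a negative one skips its first instruction \<open>rt.set:T\<close>.\<close>

definition block :: "nat \<Rightarrow> ('f, 'm) action \<Rightarrow> nat \<Rightarrow> nat \<Rightarrow> ('f, 'm) action instr list" where
  "block i c p q = PosTest (st i, get) # PosTest c # update_block i p q"

definition marked :: "nat \<Rightarrow> 'f \<Rightarrow> reply" where
  "marked j f = (if f = st j then TT else FF)"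

lemma marked_not_BB [simp]: "BB \<notin> marked j ` F"
  by (auto simp: marked_def)

lemma marked_st [simp]: "marked i (st i) = TT"
  by (simp add: marked_def)

lemma st_eq_iff: "1 \<le> i \<Longrightarrow> 1 \<le> j \<Longrightarrow> st i = st j \<longleftrightarrow> i = j"
  using foci_distinct(1) by (auto simp: inj_on_def)

lemma st_neq: "1 \<le> i \<Longrightarrow> st i \<noteq> rt" "1 \<le> i \<Longrightarrow> st i \<noteq> rf"
  using foci_distinct(3) by auto

lemma rt_neq_rf: "rt \<noteq> rf"
  using foci_distinct(2) by auto

lemma marked_other: "1 \<le> i \<Longrightarrow> 1 \<le> j \<Longrightarrow> i \<noteq> j \<Longrightarrow> marked j (st i) = FF"
  by (simp add: marked_def st_eq_iff)

lemmas focus_simps = st_eq_iff st_neq st_neq[symmetric] rt_neq_rf rt_neq_rf[symmetric]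

text \<open>The cases are: \<open>i\<close> not current, positive reply, negative reply (entry at
  \<open>tl\<close>). Since \<open>st i\<close> is cleared before the new mark is set,
  \<open>p = i\<close> and \<open>q = i\<close> are covered.\<close>

lemma run_update_block:
  assumes "1 \<le> i" "1 \<le> j" "1 \<le> p" "1 \<le> q"
  shows "i \<noteq> j \<Longrightarrow> run_regs (update_block i p q) (marked j) = marked j"
    and "run_regs (update_block i p q) (marked i) = marked p"
    and "run_regs (tl (update_block i p q)) (marked i) = marked q"
  using assms by (auto simp: update_block_def marked_def focus_simps fun_eq_iff)

lemma reg_instrs_update_block:
  "{st i, st p, st q, rt, rf} \<subseteq> F \<Longrightarrow> reg_instrs F (update_block i p q)"
  by (simp add: update_block_def)

lemma length_update_block [simp]: "length (update_block i p q) = 12"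
  by (simp add: update_block_def)

lemma length_block: "length (block i c p q) = 14"
  by (simp add: block_def)

section \<open>Passing through one block\<close>

context
  fixes fs :: "'f list" and s :: "('f, 'm) action iseq" and k i p q :: nat
  assumes fs: "distinct fs" "{st i, st p, st q, rt, rf} \<subseteq> set fs"
    and pos: "1 \<le> i" "1 \<le> p" "1 \<le> q"
begin

lemma use_seq_block_other:
  assumes "occurs_at s k (block i c p q)" "1 \<le> j" "j \<noteq> i"
  shows "use_seq fs s k (marked j) = use_seq fs s (k + 14) (marked j)"
proof -
  have "use_seq fs s k (marked j) = use_seq fs s (k + 2) (marked j)"
    using assms fs pos by (simp add: use_seq_def block_def seq_thread_pos use_regs_get marked_other)
  also have "\<dots> = use_seq fs s (k + 2 + length (update_block i p q))
      (run_regs (update_block i p q) (marked j))"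
    using assms fs
    by (intro use_seq_run_regs reg_instrs_update_block) (simp_all add: block_def)
  finally show ?thesis
    using assms pos by (simp add: run_update_block add.commute)
qed

lemma use_seq_block_current:
  assumes "occurs_at s k (block i c p q)" "fst c \<notin> set fs"
  shows "use_seq fs s k (marked i) =
    postcond M (use_seq fs s (k + 14) (marked p)) c (use_seq fs s (k + 14) (marked q))"
proof -
  let ?us = "update_block i p q"
  have ins: "reg_instrs (set fs) ?us" using fs by (intro reg_instrs_update_block)
  have occ: "occurs_at s (k + 2) ?us" using assms(1) by (simp add: block_def)
  have "use_seq fs s k (marked i) = use_seq fs s (k + 1) (marked i)"
    using assms fs by (simp add: use_seq_def block_def seq_thread_pos use_regs_get)
  \<comment> \<open>The focus of \<open>c\<close> is none of \<open>fs\<close>, so \<open>c\<close>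
    passes all the use operators.\<close>
  also have "\<dots> = postcond M (use_seq fs s (k + 2) (marked i)) c (use_seq fs s (k + 3) (marked i))"
    using assms by (simp add: use_seq_def block_def seq_thread_pos use_regs_other numeral_3_eq_3)
  also have "use_seq fs s (k + 2) (marked i) =
      use_seq fs s (k + 2 + length ?us) (run_regs ?us (marked i))"
    using ins occ fs by (intro use_seq_run_regs) simp_all
  also have "use_seq fs s (k + 3) (marked i) =
      use_seq fs s (k + 3 + length (tl ?us)) (run_regs (tl ?us) (marked i))"
    using reg_instrs_tl[OF ins] occ fs
    by (intro use_seq_run_regs) (simp_all add: update_block_def numeral_eq_Suc)
  finally show ?thesis
    using pos by (simp add: run_update_block add.commute)
qed

end

section \<open>The whole program and its passes\<close>

context
  fixes n :: nat and l r :: "nat \<Rightarrow> nat" and a :: "nat \<Rightarrow> ('f, 'm) action"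
  assumes targets: "i \<in> {1..n} \<Longrightarrow> l i \<in> {1..n + 2} \<and> r i \<in> {1..n + 2}"
    and external: "i \<in> {1..n} \<Longrightarrow> fst (a i) \<notin> st ` {1..n + 2} \<union> {rt, rf, en, sk}"
begin

definition blocks :: "('f, 'm) action instr list" where
  "blocks = concat (map (\<lambda>i. block i (a i) (l i) (r i)) [1..<n + 1])"

definition body :: "('f, 'm) action instr list" where
  "body = blocks @ [PosTest (st (n + 1), get), Halt, Basic (sk, setF)]"

definition program :: "('f, 'm) action pga" where
  "program = Prim (Basic (st 1, setT)) ;; Repeat (pga_of_list (hd body) (tl body))"

abbreviation "sp \<equiv> pga_seq program"

text \<open>\<open>sk\<close> is left out so that its action at the end of a pass stays visible and
  guards the equation for the deadlock state.\<close>

definition inner_foci :: "'f list" where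
  "inner_foci = map st [1..<n + 3] @ [rt, rf, en]"

lemma inner_foci: "distinct inner_foci" "set inner_foci = st ` {1..n + 2} \<union> {rt, rf, en}"
    "sk \<notin> set inner_foci"
proof -
  have "inj_on st (set [1..<n + 3])"
    using foci_distinct(1) by (rule inj_on_subset) auto
  moreover show set: "set inner_foci = st ` {1..n + 2} \<union> {rt, rf, en}"
    by (auto simp: inner_foci_def)
  ultimately show "distinct inner_foci"
    using foci_distinct(2,3) by (auto simp: inner_foci_def distinct_map)
  show "sk \<notin> set inner_foci"
    using foci_distinct(2,3) unfolding set by auto
qed

lemma length_blocks: "length blocks = 14 * n"
  by (simp add: blocks_def length_concat comp_def length_block sum_list_triv)

lemma body_Cons: "hd body # tl body = body"
  by (simp add: body_def)

lemma length_body: "length body = 14 * n + 3"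
  by (simp add: body_def length_blocks)

lemma jump_free_program: "jump_free program"
  unfolding jump_free_def program_def instrs.simps pga_of_list_simps body_Cons
  by (auto simp: body_def blocks_def block_def update_block_def)

lemma sp_0: "sp 0 = Some (Basic (st 1, setT))"
  by (simp add: program_def)

lemma sp_Suc: "sp (Suc k) = Some (body ! (k mod length body))"
proof -
  have len: "Suc (length (tl body)) = length body" using body_Cons by (metis length_Cons)
  have "k mod length body < length body" using length_body by simp
  then show ?thesis
    using pga_seq_pga_of_list[of "k mod length body" "tl body" "hd body"]
    unfolding len body_Cons by (simp add: program_def len del: length_tl)
qed

lemma occurs_at_body: "occurs_at sp 1 body"
  by (simp add: occurs_at_def sp_Suc)

text \<open>Position \<open>14 * n + 4\<close> is one body length after position 1; by repetition
  the two suffixes coincide.\<close>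

lemma seq_thread_wrap: "seq_thread M sp (14 * n + 4) = seq_thread M sp 1"
proof (rule seq_thread_cong, rule ext)
  fix i
  have "sp (Suc (length body + i)) = sp (Suc i)" by (simp only: sp_Suc mod_add_self1)
  then show "suffix (14 * n + 4) sp i = suffix 1 sp i"
    by (simp add: suffix_def length_body add.commute add.left_commute)
qed

text \<open>\<open>k\<close> counts the blocks already passed, so the next block is that of
  \<open>Suc k\<close>, and \<open>k = n\<close> is the test for termination. The 1 accounts for the
  initial instruction.\<close>

definition at_block :: "nat \<Rightarrow> nat \<Rightarrow> 't" where
  "at_block k j = use_seq inner_foci sp (1 + 14 * k) (marked j)"

lemma occurs_at_block:
  assumes "k < n"
  shows "occurs_at sp (1 + 14 * k) (block (Suc k) (a (Suc k)) (l (Suc k)) (r (Suc k)))"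
proof -
  have "occurs_at sp 1 blocks" using occurs_at_body by (simp add: body_def)
  then show ?thesis
    using occurs_at_concat[of sp 1 "\<lambda>i. block i (a i) (l i) (r i)" "[1..<n + 1]" 14 k] assms
    by (simp add: blocks_def length_block del: upt_Suc)
qed

lemma block_foci:
  "k < n \<Longrightarrow> {st (Suc k), st (l (Suc k)), st (r (Suc k)), rt, rf} \<subseteq> set inner_foci"
  using targets[of "Suc k"] by (auto simp: inner_foci)

lemma at_block_other:
  assumes "k < n" "1 \<le> j" "j \<noteq> Suc k"
  shows "at_block k j = at_block (Suc k) j"
  using use_seq_block_other[OF inner_foci(1) block_foci _ _ _ occurs_at_block] assms
    targets[of "Suc k"]
  by (simp add: at_block_def)

text \<open>An action on a register focus would be consumed instead of staying visible;
  \<open>external\<close> rules this out.\<close>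

lemma at_block_current:
  assumes "k < n"
  shows "at_block k (Suc k) =
    postcond M (at_block (Suc k) (l (Suc k))) (a (Suc k)) (at_block (Suc k) (r (Suc k)))"
  using use_seq_block_current[OF inner_foci(1) block_foci _ _ _ occurs_at_block] assms
    targets[of "Suc k"] external[of "Suc k"]
  by (simp add: at_block_def inner_foci)

text \<open>A false \<open>st (n + 1)\<close> skips \<open>Halt\<close>; the action on
  \<open>sk\<close> then leads back to the first block.\<close>

lemma at_block_end:
  assumes "1 \<le> j"
  shows "at_block n j = (if j = n + 1 then terminated M
    else postcond M (at_block 0 j) (sk, setF) (at_block 0 j))"
proof -
  let ?k = "1 + 14 * n"
  have sp: "sp ?k = Some (PosTest (st (n + 1), get))" "sp (?k + 1) = Some Halt"
      "sp (?k + 2) = Some (Basic (sk, setF))"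
    using occurs_at_body by (simp_all add: body_def length_blocks)
  have "st (n + 1) \<in> set inner_foci" by (auto simp: inner_foci)
  then have "at_block n j =
      use_seq inner_foci sp (?k + (if j = n + 1 then 1 else 2)) (marked j)"
    using assms sp(1) marked_other[of "n + 1" j]
    by (simp add: at_block_def use_seq_def seq_thread_pos use_regs_get inner_foci(1))
  then show ?thesis
    using sp(2,3) seq_thread_wrap inner_foci(3)
    by (simp add: at_block_def use_seq_def seq_thread_halt use_regs_terminated seq_thread_basic
        use_regs_other numeral_eq_Suc)
qed

section \<open>The state threads solve the specification\<close>

definition state_thread :: "nat \<Rightarrow> nat \<Rightarrow> 't" where
  "state_thread k j = use_op M sk (at_block k j) (reg FF)"

text \<open>For \<open>k < j\<close> the first \<open>k\<close> blocks belong to smaller indices and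
  are passed unchanged from the start. Otherwise all remaining blocks belong to larger indices, so
  the end is reached and the pass wraps around.\<close>

lemma state_thread_0:
  assumes "k \<le> n" "1 \<le> j" "j \<noteq> n + 1"
  shows "state_thread k j = state_thread 0 j"
proof -
  \<comment> \<open>\<open>sk.set:F\<close> replies false and leaves \<open>sk\<close> false, so
    wrapping around is silent.\<close>
  have wrap: "state_thread n j = state_thread 0 j"
    using assms by (simp add: state_thread_def at_block_end use_false)
  show ?thesis
  proof (cases "k < j")
    case True
    then show ?thesis using assms(1)
    proof (induction k)
      case (Suc k)
      then show ?case using at_block_other[of k j] by (simp add: state_thread_def)
    qed simp
  next
    case False
    have "state_thread k j = state_thread n j"
      using assms(1) False
    proof (induction rule: inc_induct)
      case (step k)
      then show ?case using at_block_other[of k j] assms(2) by (simp add: state_thread_def)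
    qed simp
    then show ?thesis using wrap by simp
  qed
qed

lemma state_thread_terminated:
  assumes "k \<le> n"
  shows "state_thread k (n + 1) = terminated M"
  using assms
proof (induction rule: inc_induct)
  case base
  show ?case by (simp add: state_thread_def at_block_end use_terminated)
next
  case (step k)
  then show ?case using at_block_other[of k "n + 1"] by (simp add: state_thread_def)
qed

lemma state_thread_deadlock: "state_thread 0 (n + 2) = deadlock M"
proof -
  have "at_block 0 (n + 2) = at_block k (n + 2)" if "k \<le> n" for k
    using that
  proof (induction k)
    case (Suc k)
    then show ?case using at_block_other[of k "n + 2"] by simp
  qed simp
  \<comment> \<open>With \<open>at_block_end\<close> this yields the loop equation required by
    \<open>use_loop_deadlock\<close>.\<close>
  from this[of n] show ?thesis
    using at_block_end[of "n + 2"] unfolding state_thread_def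
    by (intro use_loop_deadlock[where m = setF]) auto
qed

lemma state_thread_step:
  assumes "i \<in> {1..n}"
  shows "state_thread 0 i = postcond M (state_thread 0 (l i)) (a i) (state_thread 0 (r i))"
proof -
  obtain k where k: "i = Suc k" "k < n" using assms by (cases i) auto
  \<comment> \<open>After \<open>a i\<close> control stands behind block \<open>i\<close>, not at
    the start of a pass; for every target state this makes no difference.\<close>
  have any: "state_thread (Suc k) j = state_thread 0 j" if "j \<in> {1..n + 2}" for j
    using that k state_thread_0[of "Suc k" j] state_thread_terminated[of "Suc k"]
      state_thread_terminated[of 0]
    by (cases "j = n + 1") auto
  have "state_thread 0 i = state_thread k i" using k state_thread_0[of k i] by simp
  also have "\<dots> = postcond M (state_thread (Suc k) (l i)) (a i) (state_thread (Suc k) (r i))"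
    using k at_block_current[of k] external[OF assms]
      use_other[of "reg FF" sk "fst (a i)" _ "snd (a i)"]
    by (auto simp: state_thread_def)
  finally show ?thesis using any targets[OF assms] by simp
qed

lemma solution_state_thread: "solution M (fin_lin_spec n l a r) 1 = state_thread 0 1"
proof -
  let ?E = "fin_lin_spec n l a r"
  have lin: "linear_spec ?E" "dom ?E = {1..n + 2}"
    using linear_fin_lin_spec targets by blast+
  have "guarded_spec ?E"
    using lin(1) by (fastforce simp: linear_spec_def guarded_spec_def)
  moreover have "solves M ?E (state_thread 0)"
    using state_thread_step state_thread_terminated[of 0] state_thread_deadlock
    by (auto simp: solves_def fin_lin_spec_def split: if_splits)
  ultimately show ?thesis using RSP[of ?E "state_thread 0" 1] lin(2) by simp
qed

lemma use_all_program:
  "use_all M (map st [1..<n + 3] @ [rt, rf, en, sk]) (thread_of M program) (reg FF)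
    = state_thread 0 1"
proof -
  let ?\<sigma> = "\<lambda>_. FF"
  have "use_all M (map st [1..<n + 3] @ [rt, rf, en, sk]) (thread_of M program) (reg FF) =
      use_op M sk (use_seq inner_foci sp 0 ?\<sigma>) (reg FF)"
    by (simp add: use_all_def use_seq_def use_regs_def inner_foci_def thread_of_seq_thread)
  \<comment> \<open>The instruction before the repetition creates the initial mark at 1.\<close>
  moreover have "use_seq inner_foci sp 0 ?\<sigma> = use_seq inner_foci sp 1 (?\<sigma>(st 1 := TT))"
    using use_seq_run_regs[of inner_foci "[Basic (st 1, setT)]" sp 0 ?\<sigma>] sp_0
    by (auto simp: inner_foci)
  moreover have "?\<sigma>(st 1 := TT) = marked 1"
    by (auto simp: marked_def)
  ultimately show ?thesis by (simp add: state_thread_def at_block_def)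
qed

end

end

theorem theorem1:
  fixes M :: "('f, 'm, 's, 't) thread_algebra"
    and st :: "nat \<Rightarrow> 'f" and rt rf en sk :: 'f
    and setT setF get :: 'm
    and emb :: "reply \<Rightarrow> 's"
    and n :: nat
    and l r :: "nat \<Rightarrow> nat"
    and a :: "nat \<Rightarrow> ('f, 'm) action"
  assumes "bta_model M"
    and "register_names st rt rf en sk setT setF get"
    and "inj emb"
    and "\<And>i. i \<in> {1..n} \<Longrightarrow> l i \<in> {1..n + 2} \<and> r i \<in> {1..n + 2}"
    and "\<And>i. i \<in> {1..n} \<Longrightarrow> fst (a i) \<notin> st ` {1..n + 2} \<union> {rt, rf, en, sk}"
  shows "\<exists>P. jump_free P \<and>
    solution M (fin_lin_spec n l a r) 1 =
      use_all M (map st [1..<n + 3] @ [rt, rf, en, sk]) (thread_of M P)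
        (BR setT setF get emb FF)"
proof -
  interpret bta_registers M st rt rf en sk setT setF get emb
    using assms(1-3) by (simp add: bta_registers_def bta_registers_axioms_def)
  show ?thesis
  proof (intro exI conjI)
    show "jump_free (program n l r a)"
      using assms(4,5) by (rule jump_free_program)
    show "solution M (fin_lin_spec n l a r) 1 =
        use_all M (map st [1..<n + 3] @ [rt, rf, en, sk]) (thread_of M (program n l r a)) (reg FF)"
      using solution_state_thread[OF assms(4,5)] use_all_program[OF assms(4,5)] by (rule trans[OF _ sym])
  qed
qed

end
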